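(* Let $p$ be twice differentiable on $\mathbb{R}$ with $p''$ a function of bounded variation, $\mathbf{V}(p'')=V_2<\infty$, and let $p$ be bounded by $a$. If $h_n=h_0n^{-1/3}$ for some constant $h_0>0$, then the kernel estimator $p_n=p_{n,h_n}$ satisfies $$\sup_{x\in\mathbb{R}}\mathrm{MSE}(p_n(x))\le\Bigl\{\frac{9}{4\pi^2}\mu_1^2(K)V_2^{4/3}h_0^2+\frac{2aA(K)}{h_0}\Bigr\}n^{-2/3}.$$
   Context: Let $X_1,\dots,X_n$ be i.i.d. real random variables with probability density $p$. The kernel $K$ is a square integrable probability density on $\mathbb{R}$ (its expectation need not be zero) with characteristic function $\varphi(t)=\int e^{itx}K(x)\,dx$. For a bandwidth $h>0$ set $K_h(x)=h^{-1}K(h^{-1}x)$ and $p_{n,h}(x)=\frac1n\sum_{j=1}^nK_h(x-X_j)$. Define $\mathrm{MSE}(p_{n,h}(x))=\mathrm{E}\{p_{n,h}(x)-p(x)\}^2$. Notation: $\mu_1(K)=\int|x|K(x)\,dx$, $\mu_1^2(K)=(\mu_1(K))^2$, $A(K)=\frac1{2\pi}\int|\varphi(t)|\,dt$ (assumed finite where they appear); $\mathbf{V}(g)$ is the total variation of $g$ over the whole real line. *)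

theory Defs
  imports "HOL-Probability.Probability"
begin

definition prob_density :: "(real \<Rightarrow> real) \<Rightarrow> bool" where
  "prob_density f \<longleftrightarrow>
     f \<in> borel_measurable borel \<and> (\<forall>x. 0 \<le> f x) \<and> (\<integral>\<^sup>+ x. ennreal (f x) \<partial>lborel) = 1"

text \<open>Total variation over the whole real line: the supremum of
  \<open>\<bar>g x\<^sub>1 - g x\<^sub>0\<bar> + \<dots> + \<bar>g x\<^sub>m - g x\<^bsub>m-1\<^esub>\<bar>\<close> over all finite sequences
  \<open>x\<^sub>0 \<le> \<dots> \<le> x\<^sub>m\<close>, as an extended nonnegative real, so that an infinite value is represented.\<close>

definition total_variation :: "(real \<Rightarrow> real) \<Rightarrow> ennreal" where
  "total_variation g =
     (SUP xs \<in> {xs :: real list. sorted xs}.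
        \<Sum>i<length xs - 1. ennreal \<bar>g (xs ! Suc i) - g (xs ! i)\<bar>)"

definition kernel_char :: "(real \<Rightarrow> real) \<Rightarrow> real \<Rightarrow> complex" where
  "kernel_char K = char (density lborel (\<lambda>x. ennreal (K x)))"

lemma kernel_char_eq:
  assumes "prob_density K"
  shows "kernel_char K t = (\<integral>x. iexp (t * x) * complex_of_real (K x) \<partial>lborel)"
  using assms unfolding kernel_char_def char_def prob_density_def
  by (subst integral_density) (auto simp: scaleR_conv_of_real mult.commute)

definition mu1 :: "(real \<Rightarrow> real) \<Rightarrow> real" where
  "mu1 K = (\<integral>x. \<bar>x\<bar> * K x \<partial>lborel)"

definition A_const :: "(real \<Rightarrow> real) \<Rightarrow> real" where
  "A_const K = (\<integral>t. cmod (kernel_char K t) \<partial>lborel) / (2 * pi)"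

definition scaled_kernel :: "(real \<Rightarrow> real) \<Rightarrow> real \<Rightarrow> real \<Rightarrow> real" where
  "scaled_kernel K h x = K (x / h) / h"

definition kernel_estimator ::
    "(real \<Rightarrow> real) \<Rightarrow> nat \<Rightarrow> real \<Rightarrow> (nat \<Rightarrow> 'a \<Rightarrow> real) \<Rightarrow> real \<Rightarrow> 'a \<Rightarrow> real" where
  "kernel_estimator K n h X x \<omega> = (\<Sum>j = 1..n. scaled_kernel K h (x - X j \<omega>)) / real n"

text \<open>The expectation of the nonnegative squared error is a nonnegative Lebesgue integral, so no
  integrability is presupposed (the Bochner integral would be 0 for a non-integrable function).\<close>

definition MSE :: "'a measure \<Rightarrow> ('a \<Rightarrow> real) \<Rightarrow> real \<Rightarrow> ennreal" where
  "MSE M Z \<theta> = (\<integral>\<^sup>+ \<omega>. ennreal ((Z \<omega> - \<theta>)\<^sup>2) \<partial>M)"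

definition iid_sample ::
    "'a measure \<Rightarrow> nat \<Rightarrow> (nat \<Rightarrow> 'a \<Rightarrow> real) \<Rightarrow> (real \<Rightarrow> real) \<Rightarrow> bool" where
  "iid_sample M n X p \<longleftrightarrow>
     prob_space.indep_vars M (\<lambda>_. borel) X {1..n} \<and>
     (\<forall>j\<in>{1..n}. distributed M lborel (X j) (\<lambda>x. ennreal (p x)))"

end

theory Submission
  imports Defs "HOL-Real_Asymp.Real_Asymp"
begin

text \<open>The mean squared error splits into variance plus squared bias.

  The variance is at most \<open>a \<integral>K\<^sup>2 / (n h)\<close>, and \<open>\<integral>K\<^sup>2 \<le> A(K)\<close> because \<open>K \<le> A(K)\<close> almost
  everywhere: by Levy inversion the distribution with density \<open>K\<close> gives every interval at most
  \<open>A(K)\<close> times its length.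

  The bias is at most \<open>h \<mu>\<^sub>1(K) sup \<bar>p'\<bar>\<close>. In place of Fourier analysis, \<open>sup \<bar>p'\<bar>\<close> is
  bounded by an area argument: \<open>p''\<close> takes values arbitrarily close to 0 near both ends of the
  line, so it oscillates by at most \<open>V\<^sub>2 / 2\<close>. Hence if \<open>p'\<close> equals \<open>D > 0\<close> at some point, two
  parabolic arcs around that point lie below \<open>p\<close>, and since \<open>p\<close> has area 1 they give
  \<open>10 D\<^sup>3 \<le> V\<^sub>2\<^sup>2\<close>. This is stronger than the required
  \<open>(2 \<pi> D / 3)\<^sup>3 \<le> V\<^sub>2\<^sup>2\<close>, as \<open>\<pi>\<^sup>3 \<le> 33.75\<close>.\<close>

section \<open>Area argument: curvature bounds limit the slope of a density\<close>

text \<open>If the slope at 0 is \<open>D > 0\<close>, the curvature bounds keep \<open>f'\<close>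
  above a decreasing line to the right of 0 and an increasing line to the left. Integrating these
  lines puts two parabolic arcs below \<open>f\<close>, whose joint area is at most 1. The
  right-hand side is phrased with \<open>2 * (\<alpha> + \<beta>)\<close> because
  \<open>\<alpha> + \<beta>\<close> will be close to half the total variation.\<close>

lemma cube_deriv_le_of_second_deriv_bounds:
  fixes f f' f'' :: "real \<Rightarrow> real"
  assumes f: "prob_density f"
    and f': "\<And>x. (f has_real_derivative f' x) (at x)"
    and f'': "\<And>x. (f' has_real_derivative f'' x) (at x)"
    and upper: "\<And>x. f'' x \<le> \<alpha>" and lower: "\<And>x. - \<beta> \<le> f'' x"
    and pos: "0 < \<alpha>" "0 < \<beta>"
  shows "10 * f' 0 ^ 3 \<le> (2 * (\<alpha> + \<beta>))\<^sup>2"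
proof (cases "f' 0 \<le> 0")
  case True
  then have "f' 0 ^ 3 \<le> 0" by (simp add: power3_eq_cube mult_le_0_iff)
  moreover have "0 \<le> (2 * (\<alpha> + \<beta>))\<^sup>2" by simp
  ultimately show ?thesis by linarith
next
  case False
  define D where "D = f' 0"
  have D: "D > 0" using False by (simp add: D_def)
  \<comment> \<open>The linear lower bounds \<open>D + \<alpha> * x\<close> and
    \<open>D - \<beta> * x\<close> for the slope vanish at \<open>-u\<close> and at
    \<open>v\<close>; these points limit the two arcs.\<close>
  define u v where "u = D / \<alpha>" and "v = D / \<beta>"
  have uv: "u > 0" "v > 0" "\<alpha> * u = D" "\<beta> * v = D" using D pos by (auto simp: u_def v_def)
  have nonneg: "0 \<le> f x" for x using f by (simp add: prob_density_def)
  have [measurable]: "f \<in> borel_measurable borel" using f by (simp add: prob_density_def)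
  have slope_left: "D + \<alpha> * x \<le> f' x" if "x \<le> 0" for x
  proof -
    have "f' 0 - \<alpha> * 0 \<le> f' x - \<alpha> * x"
    proof (rule DERIV_nonpos_imp_nonincreasing[OF that])
      fix y
      show "\<exists>z. ((\<lambda>x. f' x - \<alpha> * x) has_real_derivative z) (at y) \<and> z \<le> 0"
        by (rule exI[of _ "f'' y - \<alpha>"]) (use upper[of y] in \<open>auto intro!: derivative_eq_intros f''\<close>)
    qed
    then show ?thesis by (simp add: D_def)
  qed
  have slope_right: "D - \<beta> * x \<le> f' x" if "0 \<le> x" for x
  proof -
    have "f' 0 + \<beta> * 0 \<le> f' x + \<beta> * x"
    proof (rule DERIV_nonneg_imp_nondecreasing[OF that])
      fix y
      show "\<exists>z. ((\<lambda>x. f' x + \<beta> * x) has_real_derivative z) (at y) \<and> 0 \<le> z"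
        by (rule exI[of _ "f'' y + \<beta>"]) (use lower[of y] in \<open>auto intro!: derivative_eq_intros f''\<close>)
    qed
    then show ?thesis by (simp add: D_def)
  qed
  \<comment> \<open>The left arc starts at height 0, which \<open>f\<close> never falls below, with
    vertex at \<open>-u\<close>. The right arc \<open>r\<close> continues it from the height
    \<open>l 0\<close> and has its vertex at \<open>v\<close>.\<close>
  define l where "l x = \<alpha> / 2 * (x + u)\<^sup>2" for x
  define r where "r x = \<alpha> / 2 * u\<^sup>2 + D * x - \<beta> / 2 * x\<^sup>2" for x
  have [measurable]: "l \<in> borel_measurable borel" "r \<in> borel_measurable borel"
    by (simp_all add: l_def[abs_def] r_def[abs_def])
  have fl: "l x \<le> f x" if "- u \<le> x" "x \<le> 0" for x
  proof -
    have "f (-u) - l (-u) \<le> f x - l x"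
    proof (rule DERIV_nonneg_imp_nondecreasing[OF that(1)])
      fix y assume "- u \<le> y" "y \<le> x"
      then show "\<exists>z. ((\<lambda>x. f x - l x) has_real_derivative z) (at y) \<and> 0 \<le> z"
        using slope_left[of y] that uv unfolding l_def
        by (intro exI[of _ "f' y - \<alpha> * (y + u)"])
           (auto intro!: derivative_eq_intros f' simp: algebra_simps)
    qed
    with nonneg[of "-u"] show ?thesis by (simp add: l_def)
  qed
  have fr: "r x \<le> f x" if "0 \<le> x" for x
  proof -
    have "f 0 - r 0 \<le> f x - r x"
    proof (rule DERIV_nonneg_imp_nondecreasing[OF that])
      fix y assume "0 \<le> y" "y \<le> x"
      then show "\<exists>z. ((\<lambda>x. f x - r x) has_real_derivative z) (at y) \<and> 0 \<le> z"
        using slope_right[of y] unfolding r_def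
        by (intro exI[of _ "f' y - (D - \<beta> * y)"])
           (auto intro!: derivative_eq_intros f' simp: algebra_simps)
    qed
    moreover have "r 0 \<le> f 0" using fl[of 0] uv by (simp add: l_def r_def)
    ultimately show ?thesis by simp
  qed
  have r_nonneg: "0 \<le> r x" if "0 \<le> x" "x \<le> v" for x
  proof -
    have "\<beta> * x \<le> D" using mult_left_mono[OF that(2), of \<beta>] pos uv by simp
    then have "(\<beta> * x) * x \<le> D * x" using that by (intro mult_right_mono)
    moreover have "0 \<le> D * x" using D that by simp
    ultimately have "\<beta> / 2 * x\<^sup>2 \<le> D * x" by (simp add: power2_eq_square algebra_simps)
    moreover have "0 \<le> \<alpha> / 2 * u\<^sup>2" using pos by simp
    ultimately show ?thesis unfolding r_def by linarith
  qed
  have int_l: "(\<integral>\<^sup>+x. ennreal (l x) * indicator {-u..0} x \<partial>lborel) = ennreal (\<alpha> * u ^ 3 / 6)"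
    by (subst nn_integral_FTC_Icc[where F="\<lambda>x. \<alpha> / 6 * (x + u) ^ 3"])
       (use uv pos in \<open>auto intro!: derivative_eq_intros simp: l_def power2_eq_square\<close>)
  have int_r: "(\<integral>\<^sup>+x. ennreal (r x) * indicator {0..v} x \<partial>lborel)
      = ennreal (\<alpha> / 2 * u\<^sup>2 * v + D / 2 * v\<^sup>2 - \<beta> / 6 * v ^ 3)"
    by (subst nn_integral_FTC_Icc[where F="\<lambda>x. \<alpha> / 2 * u\<^sup>2 * x + D / 2 * x\<^sup>2 - \<beta> / 6 * x ^ 3"])
       (use uv pos r_nonneg in \<open>auto intro!: derivative_eq_intros simp: r_def power2_eq_square\<close>)
  have nn: "0 \<le> \<alpha> * u ^ 3 / 6" "0 \<le> \<alpha> / 2 * u\<^sup>2 * v + D / 2 * v\<^sup>2 - \<beta> / 6 * v ^ 3"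
  proof -
    show "0 \<le> \<alpha> * u ^ 3 / 6" using uv pos by simp
    have "\<beta> / 6 * v ^ 3 = D / 6 * v\<^sup>2" using uv(4) by (simp add: power2_eq_square power3_eq_cube)
    moreover have "D / 6 * v\<^sup>2 \<le> D / 2 * v\<^sup>2" using D by (intro mult_right_mono) auto
    moreover have "0 \<le> \<alpha> / 2 * u\<^sup>2 * v" using uv pos by simp
    ultimately show "0 \<le> \<alpha> / 2 * u\<^sup>2 * v + D / 2 * v\<^sup>2 - \<beta> / 6 * v ^ 3" by linarith
  qed
  have "ennreal (\<alpha> * u ^ 3 / 6 + (\<alpha> / 2 * u\<^sup>2 * v + D / 2 * v\<^sup>2 - \<beta> / 6 * v ^ 3))
      = (\<integral>\<^sup>+x. ennreal (l x) * indicator {-u..0} x + ennreal (r x) * indicator {0..v} x \<partial>lborel)"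
    unfolding ennreal_plus[OF nn] int_l[symmetric] int_r[symmetric]
    by (rule nn_integral_add[symmetric]) auto
  also have "\<dots> \<le> (\<integral>\<^sup>+x. ennreal (f x) \<partial>lborel)"
  proof (rule nn_integral_mono_AE)
    show "AE x in lborel. ennreal (l x) * indicator {-u..0} x + ennreal (r x) * indicator {0..v} x \<le> ennreal (f x)"
      \<comment> \<open>The two closed intervals share only the point 0, where the sum of the arcs
        could exceed \<open>f\<close>; this point is null.\<close>
      using AE_lborel_singleton[of 0]
      by eventually_elim (use fl fr in \<open>auto split: split_indicator intro!: ennreal_leI\<close>)
  qed
  also have "\<dots> = 1" using f by (simp add: prob_density_def)
  finally have area: "\<alpha> * u ^ 3 / 6 + (\<alpha> / 2 * u\<^sup>2 * v + D / 2 * v\<^sup>2 - \<beta> / 6 * v ^ 3) \<le> 1"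
    by (simp add: ennreal_le_1)
  have area': "\<alpha> * u ^ 3 / 6 + (\<alpha> / 2 * u\<^sup>2 * v + D / 2 * v\<^sup>2 - \<beta> / 6 * v ^ 3)
      = D ^ 3 * (1 / (6 * \<alpha>\<^sup>2) + 1 / (2 * (\<alpha> * \<beta>)) + 1 / (3 * \<beta>\<^sup>2))"
    using pos unfolding u_def v_def by (simp add: field_simps power2_eq_square power3_eq_cube)
  define s where "s = \<alpha> + \<beta>"
  have s: "s > 0" using pos by (simp add: s_def)
  \<comment> \<open>Lower bounds in terms of \<open>s\<close> alone: \<open>\<alpha>\<close> and
    \<open>\<beta>\<close> are at most \<open>s\<close>, and the mixed term uses
    \<open>4 * (\<alpha> * \<beta>) \<le> s\<^sup>2\<close>. The coefficients add up to 1/6 + 2 +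
    1/3 = 5/2.\<close>
  have "1 / (6 * s\<^sup>2) \<le> 1 / (6 * \<alpha>\<^sup>2)" "1 / (3 * s\<^sup>2) \<le> 1 / (3 * \<beta>\<^sup>2)"
    using pos by (auto intro!: divide_left_mono mult_left_mono power_mono simp: s_def)
  moreover have "2 / s\<^sup>2 \<le> 1 / (2 * (\<alpha> * \<beta>))"
  proof -
    have "4 * (\<alpha> * \<beta>) \<le> s\<^sup>2" using zero_le_power2[of "\<alpha> - \<beta>"]
      by (simp add: s_def power2_eq_square algebra_simps)
    then show ?thesis using pos s by (simp add: field_simps)
  qed
  ultimately have "1 / (6 * s\<^sup>2) + 2 / s\<^sup>2 + 1 / (3 * s\<^sup>2)
      \<le> 1 / (6 * \<alpha>\<^sup>2) + 1 / (2 * (\<alpha> * \<beta>)) + 1 / (3 * \<beta>\<^sup>2)" by linarith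
  moreover have "1 / (6 * s\<^sup>2) + 2 / s\<^sup>2 + 1 / (3 * s\<^sup>2) = 5 / (2 * s\<^sup>2)"
    using s by (simp add: field_simps)
  ultimately have "D ^ 3 * (5 / (2 * s\<^sup>2)) \<le> 1"
    using mult_left_mono[of _ _ "D ^ 3"] area area' D by fastforce
  then show ?thesis using s by (simp add: D_def[symmetric] s_def[symmetric] field_simps power_mult_distrib)
qed

section \<open>From the total variation of the second derivative to a bound on the first\<close>

text \<open>Three increments suffice for the oscillation estimate: the middle one is to be bounded,
  and the outer two lead to far points where the function is nearly 0.\<close>

lemma total_variation_ge_four_points:
  assumes "a \<le> b" "b \<le> c" "c \<le> d"
  shows "ennreal (\<bar>g b - g a\<bar> + \<bar>g c - g b\<bar> + \<bar>g d - g c\<bar>) \<le> total_variation g"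
proof -
  have "(\<Sum>i<length [a, b, c, d] - 1. ennreal \<bar>g ([a, b, c, d] ! Suc i) - g ([a, b, c, d] ! i)\<bar>)
      \<le> total_variation g"
    unfolding total_variation_def by (rule SUP_upper) (use assms in auto)
  then show ?thesis by (simp add: eval_nat_numeral ennreal_plus)
qed

text \<open>By the mean value theorem, since a function with values between 0 and \<open>a\<close>
  changes by at most \<open>a\<close> over any interval.\<close>

lemma exists_small_deriv:
  fixes f f' :: "real \<Rightarrow> real"
  assumes f': "\<And>x. (f has_real_derivative f' x) (at x)"
    and bound: "\<And>x. 0 \<le> f x" "\<And>x. f x \<le> a" and "L > 0"
  shows "\<exists>z. c < z \<and> z < c + L \<and> \<bar>f' z\<bar> \<le> a / L"
proof -
  obtain z where z: "c < z" "z < c + L" "f (c + L) - f c = (c + L - c) * f' z"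
    using MVT2[of c "c + L" f f'] f' \<open>L > 0\<close> by auto
  then have "\<bar>f (c + L) - f c\<bar> = L * \<bar>f' z\<bar>" using \<open>L > 0\<close> by (simp add: abs_mult)
  moreover have "\<bar>f (c + L) - f c\<bar> \<le> a"
    using bound(1)[of c] bound(1)[of "c + L"] bound(2)[of c] bound(2)[of "c + L"] by linarith
  ultimately have "\<bar>f' z\<bar> \<le> a / L" using \<open>L > 0\<close> by (simp add: field_simps)
  with z show ?thesis by blast
qed

text \<open>Points with small \<open>f'\<close> are chosen in the first and the last third of the
  interval. They are at least \<open>L\<close> apart, so the mean value theorem for
  \<open>f'\<close> between them gains a second factor \<open>1 / L\<close>.\<close>

lemma exists_small_second_deriv:
  fixes f f' f'' :: "real \<Rightarrow> real"
  assumes f': "\<And>x. (f has_real_derivative f' x) (at x)"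
    and f'': "\<And>x. (f' has_real_derivative f'' x) (at x)"
    and bound: "\<And>x. 0 \<le> f x" "\<And>x. f x \<le> a" and "L > 0"
  shows "\<exists>z. c < z \<and> z < c + 3 * L \<and> \<bar>f'' z\<bar> \<le> 2 * a / L\<^sup>2"
proof -
  obtain u where u: "c < u" "u < c + L" "\<bar>f' u\<bar> \<le> a / L"
    using exists_small_deriv[OF f' bound \<open>L > 0\<close>] by blast
  obtain v where v: "c + 2 * L < v" "v < c + 2 * L + L" "\<bar>f' v\<bar> \<le> a / L"
    using exists_small_deriv[OF f' bound \<open>L > 0\<close>] by blast
  have "u < v" using u v \<open>L > 0\<close> by linarith
  then obtain z where z: "u < z" "z < v" "f' v - f' u = (v - u) * f'' z"
    using MVT2[of u v f' f''] f'' by auto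
  have "L * \<bar>f'' z\<bar> \<le> (v - u) * \<bar>f'' z\<bar>" using u v by (intro mult_right_mono) auto
  also have "\<dots> = \<bar>f' v - f' u\<bar>" using z \<open>u < v\<close> by (simp add: abs_mult)
  also have "\<dots> \<le> 2 * a / L" using u v by linarith
  finally have "\<bar>f'' z\<bar> \<le> 2 * a / L\<^sup>2" using \<open>L > 0\<close> by (simp add: field_simps power2_eq_square)
  with z u v show ?thesis by (intro exI[of _ z]) auto
qed

lemma cube_deriv_le_total_variation:
  fixes f f' f'' :: "real \<Rightarrow> real"
  assumes f: "prob_density f"
    and f': "\<And>x. (f has_real_derivative f' x) (at x)"
    and f'': "\<And>x. (f' has_real_derivative f'' x) (at x)"
    and bound: "\<And>x. f x \<le> a"
    and V: "0 \<le> V" "total_variation f'' = ennreal V"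
  shows "10 * \<bar>f' x\<bar> ^ 3 \<le> V\<^sup>2"
proof -
  have nonneg: "0 \<le> f x" for x using f by (simp add: prob_density_def)
  have small: "\<exists>z. c < z \<and> z < c + 3 * L \<and> \<bar>f'' z\<bar> \<le> 2 * a / L\<^sup>2" if "L > 0" for c L
    using exists_small_second_deriv[OF f' f'' nonneg bound that] .
  have tendsto: "((\<lambda>L. 2 * a / L\<^sup>2) \<longlongrightarrow> 0) at_top" by real_asymp
  have var: "\<bar>f'' b - f'' x\<bar> + \<bar>f'' c - f'' b\<bar> + \<bar>f'' d - f'' c\<bar> \<le> V"
    if "x \<le> b" "b \<le> c" "c \<le> d" for x b c d
    using total_variation_ge_four_points[OF that, of f''] V by (simp del: ennreal_plus)
  have osc': "\<bar>f'' y - f'' x\<bar> \<le> V / 2" if "x \<le> y" for x y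
  proof -
    \<comment> \<open>Points \<open>z\<close> left of \<open>x\<close> and \<open>w\<close> right of
      \<open>y\<close> are taken where \<open>f''\<close> is small. A path from 0 back to 0 through
      \<open>x\<close> and \<open>y\<close> covers the oscillation twice, so twice the oscillation
      exceeds \<open>V\<close> by at most the two small values, which tend to 0 as \<open>L\<close>
      grows.\<close>
    have "2 * \<bar>f'' y - f'' x\<bar> - V \<le> 0"
    proof (rule tendsto_le[OF _ _ tendsto_const])
      show "((\<lambda>L. 2 * (2 * a / L\<^sup>2)) \<longlongrightarrow> 0) at_top" by real_asymp
      show "\<forall>\<^sub>F L in at_top. 2 * \<bar>f'' y - f'' x\<bar> - V \<le> 2 * (2 * a / L\<^sup>2)"
        using eventually_gt_at_top[of 0]
      proof eventually_elim
        case (elim L)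
        obtain z where z: "x - 3 * L < z" "z < x - 3 * L + 3 * L" "\<bar>f'' z\<bar> \<le> 2 * a / L\<^sup>2"
          using small[OF elim] by blast
        obtain w where w: "y < w" "\<bar>f'' w\<bar> \<le> 2 * a / L\<^sup>2"
          using small[OF elim] by blast
        have "\<bar>f'' x - f'' z\<bar> + \<bar>f'' y - f'' x\<bar> + \<bar>f'' w - f'' y\<bar> \<le> V"
          using var[of z x y w] z w that by auto
        moreover have "\<bar>f'' y - f'' x\<bar> \<le> \<bar>f'' x - f'' z\<bar> + \<bar>f'' w - f'' y\<bar> + \<bar>f'' w\<bar> + \<bar>f'' z\<bar>"
          by linarith
        ultimately show ?case using z(3) w(2) by argo
      qed
    qed simp
    then show ?thesis by simp
  qed
  have osc: "f'' x - f'' y \<le> V / 2" for x y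
    using osc'[of x y] osc'[of y x] linear[of x y] by linarith
  define S I where "S = (SUP x. f'' x)" and "I = (INF x. f'' x)"
  have osc_le: "f'' x \<le> f'' y + V / 2" for x y using osc[of x y] by linarith
  have "bdd_above (range f'')" using osc_le by (rule bdd_aboveI2)
  then have S: "f'' x \<le> S" for x unfolding S_def by (intro cSUP_upper) auto
  have "f'' 0 - V / 2 \<le> f'' x" for x using osc[of 0 x] by linarith
  then have "bdd_below (range f'')" by (rule bdd_belowI2)
  then have I: "I \<le> f'' x" for x unfolding I_def by (intro cINF_lower) auto
  have "S \<le> f'' y + V / 2" for y
    unfolding S_def using osc_le by (intro cSUP_least) auto
  then have "S - V / 2 \<le> f'' y" for y by (simp only: diff_le_eq)
  then have "S - V / 2 \<le> I" unfolding I_def by (intro cINF_greatest) auto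
  then have SI: "S - I \<le> V / 2" by simp
  \<comment> \<open>The values of \<open>f''\<close> come arbitrarily close to 0, so 0 lies between
    its infimum and its supremum.\<close>
  have "0 \<le> S \<and> I \<le> 0"
  proof
    have "- (2 * a / L\<^sup>2) \<le> S" if L: "L > 0" for L
    proof -
      obtain z where "\<bar>f'' z\<bar> \<le> 2 * a / L\<^sup>2" using small[OF L] by blast
      with S[of z] show ?thesis by argo
    qed
    then have "\<forall>\<^sub>F L in at_top. - (2 * a / L\<^sup>2) \<le> S" by (auto intro: eventually_mono[OF eventually_gt_at_top[of 0]])
    moreover have "((\<lambda>L. - (2 * a / L\<^sup>2)) \<longlongrightarrow> 0) at_top" by real_asymp
    ultimately show "0 \<le> S" by (intro tendsto_upperbound) auto
    have "I \<le> 2 * a / L\<^sup>2" if L: "L > 0" for L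
    proof -
      obtain z where "\<bar>f'' z\<bar> \<le> 2 * a / L\<^sup>2" using small[OF L] by blast
      with I[of z] show ?thesis by argo
    qed
    then have "\<forall>\<^sub>F L in at_top. I \<le> 2 * a / L\<^sup>2" by (auto intro: eventually_mono[OF eventually_gt_at_top[of 0]])
    with tendsto show "I \<le> 0" by (intro tendsto_lowerbound) auto
  qed
  then have "0 \<le> S" "I \<le> 0" by auto
  \<comment> \<open>The area lemma needs strictly positive curvature bounds, whereas
    \<open>S\<close> or \<open>I\<close> may be 0. Hence \<open>S + \<delta>\<close> and
    \<open>\<delta> - I\<close> are used; twice their sum is at most
    \<open>V + 4 * \<delta>\<close>, and \<open>\<delta>\<close> tends to 0 at the end.\<close>
  have cube: "10 * \<bar>f' x\<bar> ^ 3 \<le> (V + 4 * \<delta>)\<^sup>2" if "\<delta> > 0" for \<delta>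
  proof -
    have le: "(2 * ((S + \<delta>) + (\<delta> - I)))\<^sup>2 \<le> (V + 4 * \<delta>)\<^sup>2"
      using SI \<open>0 \<le> S\<close> \<open>I \<le> 0\<close> that by (intro power_mono) auto
    have dens: "prob_density (\<lambda>t. f (x + c * t))" if "\<bar>c\<bar> = 1" for c
    proof -
      have [measurable]: "f \<in> borel_measurable borel" using f by (simp add: prob_density_def)
      have "(\<integral>\<^sup>+ t. ennreal (f (x + c * t)) \<partial>lborel) = 1"
        using f nn_integral_real_affine[of "\<lambda>t. ennreal (f t)" c x] that
        by (simp add: prob_density_def)
      then show ?thesis by (simp add: prob_density_def nonneg)
    qed
    \<comment> \<open>Translation moves \<open>x\<close> to the origin. The reflection
      \<open>c = -1\<close> covers negative slopes: it flips the sign of \<open>f'\<close> but, as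
      \<open>c * c = 1\<close>, leaves the curvature bounds unchanged.\<close>
    have "10 * (c * f' (x + c * 0)) ^ 3 \<le> (2 * ((S + \<delta>) + (\<delta> - I)))\<^sup>2" if c: "\<bar>c\<bar> = 1" for c
    proof (rule cube_deriv_le_of_second_deriv_bounds[where f'="\<lambda>t. c * f' (x + c * t)" and f''="\<lambda>t. f'' (x + c * t)"])
      show "prob_density (\<lambda>t. f (x + c * t))" by (rule dens[OF c])
      show "((\<lambda>t. f (x + c * t)) has_real_derivative c * f' (x + c * t)) (at t)" for t
        by (auto intro!: derivative_eq_intros f'[THEN DERIV_chain2, THEN DERIV_cong])
      have "c * c = 1" using c by (metis abs_mult_self_eq mult_1)
      then show "((\<lambda>t. c * f' (x + c * t)) has_real_derivative f'' (x + c * t)) (at t)" for t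
        by (intro DERIV_cmult[THEN DERIV_cong, OF f''[THEN DERIV_chain2]]) (auto intro!: derivative_eq_intros)
      show "f'' (x + c * t) \<le> S + \<delta>" "- (\<delta> - I) \<le> f'' (x + c * t)" for t
        using S[of "x + c * t"] I[of "x + c * t"] \<open>\<delta> > 0\<close> by auto
    qed (use \<open>\<delta> > 0\<close> \<open>0 \<le> S\<close> \<open>I \<le> 0\<close> in auto)
    from this[of 1] this[of "-1"] le show ?thesis by (auto simp: abs_if)
  qed
  show ?thesis
  proof (rule tendsto_lowerbound)
    show "((\<lambda>\<delta>. (V + 4 * \<delta>)\<^sup>2) \<longlongrightarrow> V\<^sup>2) (at_right 0)" by (auto intro!: tendsto_eq_intros)
    show "\<forall>\<^sub>F \<delta> in at_right 0. 10 * \<bar>f' x\<bar> ^ 3 \<le> (V + 4 * \<delta>)\<^sup>2"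
      using cube by (auto simp: eventually_at_right_less intro: eventually_mono[OF eventually_at_right_less])
  qed simp
qed

lemma deriv_sq_le_total_variation:
  fixes f f' f'' :: "real \<Rightarrow> real"
  assumes f: "prob_density f"
    and f': "\<And>x. (f has_real_derivative f' x) (at x)"
    and f'': "\<And>x. (f' has_real_derivative f'' x) (at x)"
    and bound: "\<And>x. f x \<le> a"
    and V: "0 \<le> V" "total_variation f'' = ennreal V"
  shows "(f' x)\<^sup>2 \<le> 9 / (4 * pi\<^sup>2) * V powr (4/3)"
proof (rule power_le_imp_le_base[of _ 2])
  \<comment> \<open>Both sides are compared after cubing, which removes the exponent 4/3. The
    constant fits because \<open>3.2 ^ 6\<close> is about 1074, while 72900 / 64 is about
    1139.\<close>
  have "pi ^ 6 \<le> 3.2 ^ 6" using pi_approx by (intro power_mono) auto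
  then have "1 / 100 \<le> 729 / (64 * pi ^ 6)" by (simp add: field_simps)
  then have const: "1 / 100 * V ^ 4 \<le> 729 / (64 * pi ^ 6) * V ^ 4" by (intro mult_right_mono) auto
  have "(10 * \<bar>f' x\<bar> ^ 3)\<^sup>2 \<le> (V\<^sup>2)\<^sup>2"
    using cube_deriv_le_total_variation[OF assms] by (intro power_mono) auto
  then have "(f' x)\<^sup>2 ^ 3 \<le> 1 / 100 * V ^ 4"
    by (simp add: power_mult_distrib power_mult[symmetric])
  also note const
  also have "729 / (64 * pi ^ 6) * V ^ 4 = (9 / (4 * pi\<^sup>2) * V powr (4/3)) ^ 3"
  proof -
    have "(V powr (4/3)) ^ 3 = V ^ 4"
    proof (cases "V = 0")
      case False
      then have "V > 0" using V by simp
      then have "(V powr (4/3)) ^ 3 = (V powr (4/3)) powr 3" by simp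
      also have "\<dots> = V powr 4" by (simp only: powr_powr) simp
      finally show ?thesis using \<open>V > 0\<close> by simp
    qed simp
    then show ?thesis by (simp add: power_mult_distrib power_divide power_mult[symmetric])
  qed
  finally show "(f' x)\<^sup>2 ^ Suc 2 \<le> (9 / (4 * pi\<^sup>2) * V powr (4/3)) ^ Suc 2"
    by (simp add: numeral_3_eq_3)
qed simp

section \<open>A pointwise bound on a density from its characteristic function\<close>

text \<open>The function \<open>x \<mapsto> B x - cdf M x\<close> is nondecreasing, so it defines a measure that complements
  \<open>M\<close> to \<open>B\<close> times Lebesgue measure.\<close>

lemma (in finite_borel_measure) emeasure_le_lborel:
  assumes "0 < B" and Ioc: "\<And>a b. a \<le> b \<Longrightarrow> measure M {a<..b} \<le> B * (b - a)"
    and S: "S \<in> sets borel"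
  shows "emeasure M S \<le> ennreal B * emeasure lborel S"
proof -
  define F where "F x = B * x - cdf M x" for x
  have cdf_diff: "cdf M b - cdf M a = measure M {a<..b}" if "a \<le> b" for a b
    using cdf_diff_eq[of a b] that by (cases "a = b") auto
  have mono: "F x \<le> F y" if "x \<le> y" for x y
    using Ioc[OF that] cdf_diff[OF that] by (simp add: F_def algebra_simps)
  have cont: "continuous (at_right a) F" for a
    unfolding F_def by (intro continuous_intros cdf_is_right_cont)
  define \<nu> where "\<nu> = interval_measure F"
  have sets_\<nu>: "sets \<nu> = sets borel" by (simp add: \<nu>_def)
  \<comment> \<open>The sum of \<open>M\<close> and \<open>\<nu>\<close>. On half-open intervals the
    cdf terms cancel, leaving \<open>B\<close> times the length.\<close>
  define N where "N = measure_of UNIV (sets borel) (\<lambda>A. emeasure M A + emeasure \<nu> A)"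
  have sets_N: "sets N = sets borel"
    unfolding N_def using sets.sigma_sets_eq[of borel] by (simp add: sets_measure_of)
  have N: "emeasure N A = emeasure M A + emeasure \<nu> A" if "A \<in> sets borel" for A
  proof (rule emeasure_measure_of[OF N_def])
    show "positive (sets N) (\<lambda>A. emeasure M A + emeasure \<nu> A)" by (simp add: positive_def)
    show "countably_additive (sets N) (\<lambda>A. emeasure M A + emeasure \<nu> A)"
      unfolding countably_additive_def sets_N
    proof safe
      fix A :: "nat \<Rightarrow> real set"
      assume A: "range A \<subseteq> sets borel" "disjoint_family A"
      then have "(\<Sum>i. emeasure M (A i) + emeasure \<nu> (A i))
          = (\<Sum>i. emeasure M (A i)) + (\<Sum>i. emeasure \<nu> (A i))"
        by (intro suminf_add[symmetric]) auto
      then show "(\<Sum>i. emeasure M (A i) + emeasure \<nu> (A i))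
          = emeasure M (\<Union>(range A)) + emeasure \<nu> (\<Union>(range A))"
        using A by (simp add: suminf_emeasure sets_\<nu> M_is_borel)
    qed
  qed (use that sets_N in auto)
  have lborel_Ioc: "emeasure (density lborel (\<lambda>_. ennreal B)) {a<..b} = ennreal (B * (b - a))" if "a \<le> b" for a b
    using that \<open>0 < B\<close> by (simp add: emeasure_density ennreal_mult nn_integral_cmult_indicator)
  have N_Ioc: "emeasure N {a<..b} = ennreal (B * (b - a))" if "a \<le> b" for a b
  proof -
    have "emeasure N {a<..b} = ennreal (cdf M b - cdf M a) + ennreal (F b - F a)"
      using that mono cont by (simp add: N emeasure_Ioc \<nu>_def emeasure_interval_measure_Ioc)
    also have "\<dots> = ennreal (B * (b - a))"
      using mono[OF that] cdf_nondecreasing[OF that]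
      by (subst ennreal_plus[symmetric]) (auto simp: F_def algebra_simps)
    finally show ?thesis .
  qed
  \<comment> \<open>Half-open intervals form an intersection-stable generator, and the intervals
    from \<open>-i\<close> to \<open>i\<close> exhaust the line with finite measure, so agreement
    there determines the measure.\<close>
  have "N = density lborel (\<lambda>_. ennreal B)"
  proof (rule measure_eqI_generator_eq[where \<Omega>=UNIV])
    fix X assume "X \<in> range (\<lambda>(a, b). {a<..b::real})"
    then obtain a b where X: "X = {a<..b}" by auto
    then show "emeasure N X = emeasure (density lborel (\<lambda>_. ennreal B)) X"
      by (cases "a \<le> b") (simp_all add: N_Ioc lborel_Ioc)
  next
    show "(\<Union>i. {- real (i::nat)<..real i}) = UNIV" by (rule UN_Ioc_eq_UNIV)
  qed (auto simp: N_Ioc sets_N borel_sigma_sets_Ioc Int_stable_def)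
  then have "emeasure M S + emeasure \<nu> S = ennreal B * emeasure lborel S"
    using N[OF S] S by (simp add: emeasure_density nn_integral_cmult_indicator)
  then show ?thesis by (metis add_increasing2 order_refl zero_le)
qed

text \<open>If \<open>f > B\<close> held on a set of positive measure, integrating over that set
  would contradict the assumed comparison of measures.\<close>

lemma AE_le_of_emeasure_density_le:
  fixes f :: "real \<Rightarrow> real"
  assumes [measurable]: "f \<in> borel_measurable borel" and "0 \<le> B"
    and le: "\<And>S. S \<in> sets borel \<Longrightarrow>
      emeasure (density lborel (\<lambda>x. ennreal (f x))) S \<le> ennreal B * emeasure lborel S"
  shows "AE x in lborel. f x \<le> B"
proof -
  \<comment> \<open>Restriction to a bounded interval makes the integral of \<open>B\<close> over
    the exceptional set finite, as the strict comparison of integrals requires.\<close>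
  have "AE x in lborel. x \<in> {- real n..real n} \<longrightarrow> f x \<le> B" for n
  proof (rule ccontr)
    assume *: "\<not> (AE x in lborel. x \<in> {- real n..real n} \<longrightarrow> f x \<le> B)"
    define E where "E = {x \<in> {- real n..real n}. B < f x}"
    have [measurable]: "E \<in> sets borel" unfolding E_def by measurable
    have "emeasure lborel E \<le> emeasure lborel {- real n..real n}"
      by (intro emeasure_mono) (auto simp: E_def)
    then have fin: "ennreal B * emeasure lborel E < \<infinity>"
      by (simp add: ennreal_mult_less_top order_le_less_trans)
    have "(\<integral>\<^sup>+x. ennreal B * indicator E x \<partial>lborel) < (\<integral>\<^sup>+x. ennreal (f x) * indicator E x \<partial>lborel)"
    proof (rule nn_integral_less)
      show "(\<integral>\<^sup>+x. ennreal B * indicator E x \<partial>lborel) \<noteq> \<infinity>"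
        using fin by (simp add: nn_integral_cmult_indicator)
      show "AE x in lborel. ennreal B * indicator E x \<le> ennreal (f x) * indicator E x"
        by (intro AE_I2) (auto simp: E_def split: split_indicator intro: ennreal_leI)
      show "\<not> (AE x in lborel. ennreal (f x) * indicator E x \<le> ennreal B * indicator E x)"
      proof
        assume "AE x in lborel. ennreal (f x) * indicator E x \<le> ennreal B * indicator E x"
        then have "AE x in lborel. x \<in> {- real n..real n} \<longrightarrow> f x \<le> B"
          by eventually_elim (use \<open>0 \<le> B\<close> in \<open>auto simp: E_def ennreal_le_iff not_le split: split_indicator_asm\<close>)
        with * show False by simp
      qed
    qed auto
    also have "\<dots> \<le> ennreal B * emeasure lborel E" using le[of E] by (simp add: emeasure_density)
    finally show False by (simp add: nn_integral_cmult_indicator)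
  qed
  then have "AE x in lborel. \<forall>n. x \<in> {- real n..real n} \<longrightarrow> f x \<le> B" 
    by (intro AE_all_countable[THEN iffD2] allI)
  then show ?thesis
  proof eventually_elim
    case (elim x)
    obtain n where "\<bar>x\<bar> \<le> real n" using real_arch_simple by blast
    then have "- real n \<le> x \<and> x \<le> real n" by linarith
    with elim show ?case by auto
  qed
qed

text \<open>The factor multiplying the characteristic function in the Levy inversion formula has
  modulus at most \<open>b - a\<close>. Every truncated inversion integral thus obeys the bound, and
  so does the limit. Absence of atoms makes the formula apply at both endpoints.\<close>

lemma (in real_distribution) measure_Ioc_le_integral_norm_char:
  assumes int: "integrable lborel (char M)" and atom: "\<And>x. measure M {x} = 0" and ab: "a \<le> b"
  shows "measure M {a<..b} \<le> (\<integral>t. cmod (char M t) \<partial>lborel) / (2 * pi) * (b - a)"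
proof -
  let ?F = "\<lambda>t::real. (iexp (-(t * a)) - iexp (-(t * b))) / (\<i> * t)"
  have F: "cmod (?F t * char M t) \<le> (b - a) * cmod (char M t)" for t :: real
  \<comment> \<open>At \<open>t = 0\<close> the quotient is 0, by the convention for division by
    zero.\<close>
  proof (cases "t = 0")
    case False
    have "cmod (?F t) \<le> b - a"
      using Levy_Inversion_aux2[of "-b" "-a" t] False ab by simp
    then show ?thesis by (simp only: norm_mult mult_right_mono norm_ge_zero)
  qed (use ab in simp)
  have "cmod (complex_of_real (measure M {a<..b})) \<le> (\<integral>t. cmod (char M t) \<partial>lborel) / (2 * pi) * (b - a)"
  proof (rule LIMSEQ_le_const2[OF tendsto_norm[OF Levy_Inversion[OF ab atom atom]]], intro exI allI impI)
    fix T :: nat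
    have "cmod (CLBINT t=-T..T. ?F t * char M t)
        = cmod (\<integral>t. indicator {- real T<..<real T} t *\<^sub>R (?F t * char M t) \<partial>lborel)"
      by (simp add: interval_lebesgue_integral_def set_lebesgue_integral_def)
    also have "\<dots> \<le> (\<integral>t. (b - a) * cmod (char M t) \<partial>lborel)"
    proof (rule Bochner_Integration.integral_norm_bound_integral)
      have [measurable]: "char M \<in> borel_measurable borel"
        using borel_measurable_integrable[OF int] by simp
      show bound: "norm (indicator {- real T<..<real T} t *\<^sub>R (?F t * char M t)) \<le> (b - a) * cmod (char M t)" for t
        using F[of t] ab by (simp split: split_indicator)
      show int': "integrable lborel (\<lambda>t. (b - a) * cmod (char M t))" using int by simp
      show "integrable lborel (\<lambda>t. indicator {- real T<..<real T} t *\<^sub>R (?F t * char M t))"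
      proof (rule Bochner_Integration.integrable_bound[OF int'])
        show "AE t in lborel. norm (indicator {- real T<..<real T} t *\<^sub>R (?F t * char M t))
            \<le> norm ((b - a) * cmod (char M t))"
          using ab by (intro AE_I2 order_trans[OF bound]) simp
      qed measurable
    qed
    finally have "cmod (CLBINT t=-T..T. ?F t * char M t) \<le> (b - a) * (\<integral>t. cmod (char M t) \<partial>lborel)" by simp
    then show "cmod (1 / (2 * pi) * (CLBINT t=-T..T. ?F t * char M t))
        \<le> (\<integral>t. cmod (char M t) \<partial>lborel) / (2 * pi) * (b - a)"
      by (simp add: norm_mult norm_divide field_simps)
  qed
  then show ?thesis by simp
qed

lemma real_distribution_prob_density:
  assumes "prob_density K"
  shows "real_distribution (density lborel (\<lambda>x. ennreal (K x)))"
proof -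
  interpret prob_space "density lborel (\<lambda>x. ennreal (K x))"
    by (rule prob_spaceI) (use assms in \<open>simp add: prob_density_def emeasure_density\<close>)
  show ?thesis by standard simp
qed

lemma AE_prob_density_le_A_const:
  assumes K: "prob_density K" and int: "integrable lborel (kernel_char K)"
  shows "AE x in lborel. K x \<le> A_const K"
proof (rule AE_upper_bound_inf)
  \<comment> \<open>The slack \<open>e\<close> supplies the strictly positive constant that
    \<open>emeasure_le_lborel\<close> asks for, \<open>A_const K\<close> being only shown
    nonnegative.\<close>
  fix e :: real assume "0 < e"
  have [measurable]: "K \<in> borel_measurable borel" using K by (simp add: prob_density_def)
  interpret real_distribution "density lborel (\<lambda>x. ennreal (K x))"
    by (rule real_distribution_prob_density[OF K])
  have A: "0 \<le> A_const K" unfolding A_const_def by simp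
  have atom: "measure (density lborel (\<lambda>x. ennreal (K x))) {x} = 0" for x
  proof -
    have "AE y in lborel. y \<in> {x} \<longrightarrow> ennreal (K y) = 0"
      using AE_lborel_singleton[of x] by eventually_elim simp
    then have "{x} \<in> null_sets (density lborel (\<lambda>x. ennreal (K x)))"
      using null_sets_density_iff[of "\<lambda>x. ennreal (K x)" lborel] by simp
    then show ?thesis by (simp add: measure_def null_setsD1)
  qed
  show "AE x in lborel. K x \<le> A_const K + e"
  proof (rule AE_le_of_emeasure_density_le)
    fix S :: "real set" assume S: "S \<in> sets borel"
    show "emeasure (density lborel (\<lambda>x. ennreal (K x))) S \<le> ennreal (A_const K + e) * emeasure lborel S"
    proof (rule emeasure_le_lborel[OF _ _ S])
      fix a b :: real assume ab: "a \<le> b"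
      have "measure (density lborel (\<lambda>x. ennreal (K x))) {a<..b} \<le> A_const K * (b - a)"
        using measure_Ioc_le_integral_norm_char[OF int[unfolded kernel_char_def] atom ab]
        by (simp add: A_const_def kernel_char_def)
      also have "\<dots> \<le> (A_const K + e) * (b - a)" using \<open>0 < e\<close> ab by (intro mult_right_mono) auto
      finally show "measure (density lborel (\<lambda>x. ennreal (K x))) {a<..b} \<le> (A_const K + e) * (b - a)" .
    qed (use A \<open>0 < e\<close> in simp)
  qed (use A \<open>0 < e\<close> in auto)
qed

text \<open>Almost everywhere one factor of the square is at most \<open>A_const K\<close>, and the
  other factor integrates to 1. This takes the place of Plancherel's identity combined with the
  bound 1 on the modulus of a characteristic function.\<close>

lemma integral_square_le_A_const:
  assumes K: "prob_density K" and sq: "integrable lborel (\<lambda>x. (K x)\<^sup>2)"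
    and int: "integrable lborel (kernel_char K)"
  shows "(\<integral>x. (K x)\<^sup>2 \<partial>lborel) \<le> A_const K"
proof -
  have [measurable]: "K \<in> borel_measurable borel" and nonneg: "\<And>x. 0 \<le> K x"
    and one: "(\<integral>\<^sup>+x. ennreal (K x) \<partial>lborel) = ennreal 1"
    using K by (simp_all add: prob_density_def)
  have K1: "has_bochner_integral lborel K 1"
    using nonneg one by (intro has_bochner_integral_nn_integral) auto
  have "(\<integral>x. (K x)\<^sup>2 \<partial>lborel) \<le> (\<integral>x. A_const K * K x \<partial>lborel)"
  proof (rule integral_mono_AE[OF sq])
    show "integrable lborel (\<lambda>x. A_const K * K x)" using K1 by (auto simp: has_bochner_integral_iff)
    show "AE x in lborel. (K x)\<^sup>2 \<le> A_const K * K x"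
      using AE_prob_density_le_A_const[OF K int]
      by eventually_elim (use nonneg in \<open>auto simp: power2_eq_square intro: mult_right_mono\<close>)
  qed
  then show ?thesis using K1 by (simp add: has_bochner_integral_iff)
qed

section \<open>Mean squared error of an average of independent variables\<close>

text \<open>Induction on the index set: a new centred summand is independent of the partial sum, so
  the cross term has expectation 0.\<close>

lemma (in prob_space) expectation_sum_square_indep:
  fixes Z :: "'i \<Rightarrow> 'a \<Rightarrow> real"
  assumes "finite I" "indep_vars (\<lambda>_. borel) Z I"
    and "\<And>i. i \<in> I \<Longrightarrow> integrable M (Z i)" "\<And>i. i \<in> I \<Longrightarrow> integrable M (\<lambda>\<omega>. (Z i \<omega>)\<^sup>2)"
    and "\<And>i. i \<in> I \<Longrightarrow> expectation (Z i) = 0"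
  shows "has_bochner_integral M (\<lambda>\<omega>. (\<Sum>i\<in>I. Z i \<omega>)\<^sup>2) (\<Sum>i\<in>I. expectation (\<lambda>\<omega>. (Z i \<omega>)\<^sup>2))"
  using assms
proof (induction I rule: finite_induct)
  case (insert i I)
  let ?S = "\<lambda>\<omega>. \<Sum>j\<in>I. Z j \<omega>"
  have IH: "has_bochner_integral M (\<lambda>\<omega>. (?S \<omega>)\<^sup>2) (\<Sum>j\<in>I. expectation (\<lambda>\<omega>. (Z j \<omega>)\<^sup>2))"
    using insert.prems by (intro insert.IH) (auto intro: indep_vars_subset)
  have indep: "indep_var borel (Z i) borel ?S"
    using insert by (intro indep_vars_sum) auto
  have int: "integrable M (Z i)" "integrable M ?S"
    using insert.prems by auto
  have cross: "has_bochner_integral M (\<lambda>\<omega>. Z i \<omega> * ?S \<omega>) 0"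
    using indep_var_integrable[OF indep int] indep_var_lebesgue_integral[OF indep int] insert.prems
    by (simp add: has_bochner_integral_iff)
  have "has_bochner_integral M (\<lambda>\<omega>. (Z i \<omega>)\<^sup>2 + 2 * (Z i \<omega> * ?S \<omega>) + (?S \<omega>)\<^sup>2)
      (expectation (\<lambda>\<omega>. (Z i \<omega>)\<^sup>2) + 2 * 0 + (\<Sum>j\<in>I. expectation (\<lambda>\<omega>. (Z j \<omega>)\<^sup>2)))"
    using insert.prems
    by (intro has_bochner_integral_add has_bochner_integral_mult_right IH cross has_bochner_integral_integrable) auto
  then show ?case using insert.hyps by (simp add: power2_sum algebra_simps)
qed (simp add: has_bochner_integral_zero)

text \<open>Bias-variance decomposition: the error is the centred average plus the constant
  \<open>m - \<theta>\<close>, and the cross term has mean 0. Each variance is at most the second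
  moment.\<close>

lemma (in prob_space) nn_integral_mean_error_le:
  fixes Y :: "nat \<Rightarrow> 'a \<Rightarrow> real"
  assumes n: "n \<ge> 1" and indep: "indep_vars (\<lambda>_. borel) Y {1..n}"
    and int: "\<And>j. j \<in> {1..n} \<Longrightarrow> integrable M (Y j)"
    and sq: "\<And>j. j \<in> {1..n} \<Longrightarrow> integrable M (\<lambda>\<omega>. (Y j \<omega>)\<^sup>2)"
    and mean: "\<And>j. j \<in> {1..n} \<Longrightarrow> expectation (Y j) = m"
    and second: "\<And>j. j \<in> {1..n} \<Longrightarrow> expectation (\<lambda>\<omega>. (Y j \<omega>)\<^sup>2) \<le> s"
  shows "(\<integral>\<^sup>+\<omega>. ennreal (((\<Sum>j = 1..n. Y j \<omega>) / real n - \<theta>)\<^sup>2) \<partial>M) \<le> ennreal (s / real n + (m - \<theta>)\<^sup>2)"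
proof -
  define Z where "Z j \<omega> = Y j \<omega> - m" for j \<omega>
  have Z_int: "integrable M (Z j)" if "j \<in> {1..n}" for j
    using int[OF that] by (simp add: Z_def[abs_def])
  have Z_sq: "has_bochner_integral M (\<lambda>\<omega>. (Z j \<omega>)\<^sup>2) (expectation (\<lambda>\<omega>. (Y j \<omega>)\<^sup>2) - m\<^sup>2)" if "j \<in> {1..n}" for j
  proof -
    have "has_bochner_integral M (\<lambda>\<omega>. (Y j \<omega>)\<^sup>2 - 2 * m * Y j \<omega> + m\<^sup>2)
        (expectation (\<lambda>\<omega>. (Y j \<omega>)\<^sup>2) - 2 * m * m + m\<^sup>2)"
      using int[OF that] sq[OF that] mean[OF that] by (auto simp: has_bochner_integral_iff prob_space)
    then show ?thesis by (simp add: Z_def power2_diff power2_eq_square algebra_simps)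
  qed
  have Z_mean: "expectation (Z j) = 0" if "j \<in> {1..n}" for j
    using int[OF that] mean[OF that] by (simp add: Z_def[abs_def] prob_space)
  have Z_indep: "indep_vars (\<lambda>_. borel) Z {1..n}"
    unfolding Z_def[abs_def] by (rule indep_vars_compose2[OF indep]) simp
  let ?S = "\<lambda>\<omega>. \<Sum>j = 1..n. Z j \<omega>"
  let ?v = "\<Sum>j = 1..n. expectation (\<lambda>\<omega>. (Z j \<omega>)\<^sup>2)"
  have S_sq: "has_bochner_integral M (\<lambda>\<omega>. (?S \<omega>)\<^sup>2) ?v"
    using Z_sq by (intro expectation_sum_square_indep Z_indep Z_int Z_mean) (auto simp: has_bochner_integral_iff)
  have S: "has_bochner_integral M ?S 0"
    using Z_int Z_mean by (auto simp: has_bochner_integral_iff)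
  have eq: "((\<Sum>j = 1..n. Y j \<omega>) / real n - \<theta>)\<^sup>2
      = (?S \<omega>)\<^sup>2 / (real n)\<^sup>2 + 2 * (m - \<theta>) / real n * ?S \<omega> + (m - \<theta>)\<^sup>2" for \<omega>
  proof -
    have "(\<Sum>j = 1..n. Y j \<omega>) / real n - \<theta> = ?S \<omega> / real n + (m - \<theta>)"
      using n by (simp add: Z_def sum_subtractf diff_divide_distrib)
    then show ?thesis by (simp only: power2_sum power_divide) simp
  qed
  have "has_bochner_integral M (\<lambda>\<omega>. ((\<Sum>j = 1..n. Y j \<omega>) / real n - \<theta>)\<^sup>2)
      (?v / (real n)\<^sup>2 + 2 * (m - \<theta>) / real n * 0 + (m - \<theta>)\<^sup>2)"
    unfolding eq using S S_sq by (auto simp: has_bochner_integral_iff prob_space)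
  then have "(\<integral>\<^sup>+\<omega>. ennreal (((\<Sum>j = 1..n. Y j \<omega>) / real n - \<theta>)\<^sup>2) \<partial>M) = ennreal (?v / (real n)\<^sup>2 + (m - \<theta>)\<^sup>2)"
    by (subst nn_integral_eq_integral) (auto simp: has_bochner_integral_iff)
  also have "\<dots> \<le> ennreal (s / real n + (m - \<theta>)\<^sup>2)"
  proof -
    have "?v \<le> (\<Sum>j = 1..n. s)"
    proof (rule sum_mono)
      fix j assume j: "j \<in> {1..n}"
      have "expectation (\<lambda>\<omega>. (Z j \<omega>)\<^sup>2) = expectation (\<lambda>\<omega>. (Y j \<omega>)\<^sup>2) - m\<^sup>2"
        using Z_sq[OF j] by (simp add: has_bochner_integral_iff)
      then show "expectation (\<lambda>\<omega>. (Z j \<omega>)\<^sup>2) \<le> s"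
        using second[OF j] zero_le_power2[of m] by linarith
    qed
    then have "?v / (real n)\<^sup>2 \<le> real n * s / (real n)\<^sup>2" by (intro divide_right_mono) auto
    also have "\<dots> = s / real n" using n by (simp add: power2_eq_square)
    finally show ?thesis by (intro ennreal_leI) simp
  qed
  finally show ?thesis .
qed

section \<open>Bias and variance of the kernel estimator\<close>

text \<open>Substitution of \<open>x - h * u\<close> for \<open>y\<close>, whose Jacobian
  \<open>h\<close> cancels the division by \<open>h\<close>. The function \<open>g\<close> is left
  general to serve both the first moment, with \<open>K\<close>, and the second, with
  \<open>K\<close> squared over \<open>h\<close>.\<close>

lemma has_bochner_integral_substitute_scaled_kernel:
  fixes g p :: "real \<Rightarrow> real"
  assumes "h > 0" and "has_bochner_integral lborel (\<lambda>u. g u * p (x - h * u)) I"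
  shows "has_bochner_integral lborel (\<lambda>y. p y * (g ((x - y) / h) / h)) I"
proof -
  have u: "(x - (x + - h * u)) / h = u" "x + - h * u = x - h * u" for u using \<open>h > 0\<close> by auto
  let ?G = "\<lambda>y. p y * (g ((x - y) / h) / h)"
  have "(\<lambda>u. ?G (x + - h * u)) = (\<lambda>u. (1 / h) * (g u * p (x - h * u)))"
    unfolding u by (auto simp: mult.commute)
  then have "has_bochner_integral lborel (\<lambda>u. ?G (x + - h * u)) ((1 / h) * I)"
    using has_bochner_integral_mult_right[where c="1 / h", OF assms(2)] by simp
  then show ?thesis
    using \<open>h > 0\<close> lborel_integrable_real_affine_iff[of "-h" ?G x] lborel_integral_real_affine[of "-h" ?G x]
    by (simp only: has_bochner_integral_iff) simp
qed

text \<open>As \<open>K\<close> has integral 1, \<open>p x\<close> can be moved under the integral;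
  then \<open>p\<close> is Lipschitz with constant \<open>C\<close>. Only the first absolute moment
  enters, so no centring of \<open>K\<close> is required.\<close>

lemma bias_le:
  fixes p p' :: "real \<Rightarrow> real"
  assumes K: "prob_density K" and K_abs: "integrable lborel (\<lambda>x. \<bar>x\<bar> * K x)"
    and p': "\<And>x. (p has_real_derivative p' x) (at x)" and p'_le: "\<And>x. \<bar>p' x\<bar> \<le> C"
    and "0 \<le> h" and int: "integrable lborel (\<lambda>u. K u * p (x - h * u))"
  shows "\<bar>(\<integral>u. K u * p (x - h * u) \<partial>lborel) - p x\<bar> \<le> C * h * mu1 K"
proof -
  have K_nonneg: "0 \<le> K u" for u using K by (simp add: prob_density_def)
  have K_int: "has_bochner_integral lborel K 1"
    using K by (intro has_bochner_integral_nn_integral) (auto simp: prob_density_def)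
  have "(\<integral>u. K u * p (x - h * u) \<partial>lborel) - p x = (\<integral>u. K u * p (x - h * u) - K u * p x \<partial>lborel)"
    using K_int int by (simp add: has_bochner_integral_iff)
  also have "\<bar>\<dots>\<bar> \<le> (\<integral>u. C * h * (\<bar>u\<bar> * K u) \<partial>lborel)"
    unfolding real_norm_def[symmetric, of "integral\<^sup>L _ _"]
  proof (rule Bochner_Integration.integral_norm_bound_integral)
    show "integrable lborel (\<lambda>u. K u * p (x - h * u) - K u * p x)"
      using K_int int by (auto simp: has_bochner_integral_iff)
    show "integrable lborel (\<lambda>u. C * h * (\<bar>u\<bar> * K u))" using K_abs by simp
    fix u
    have "norm (p (x - h * u) - p x) \<le> C * norm (x - h * u - x)"
      using p' p'_le by (intro field_differentiable_bound[of UNIV p p']) auto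
    then have "\<bar>p (x - h * u) - p x\<bar> \<le> C * h * \<bar>u\<bar>"
      using \<open>0 \<le> h\<close> by (simp add: abs_mult)
    then have "K u * \<bar>p (x - h * u) - p x\<bar> \<le> K u * (C * h * \<bar>u\<bar>)"
      using K_nonneg by (intro mult_left_mono)
    then show "norm (K u * p (x - h * u) - K u * p x) \<le> C * h * (\<bar>u\<bar> * K u)"
      using K_nonneg[of u] by (simp add: abs_mult right_diff_distrib[symmetric] mult_ac)
  qed
  also have "\<dots> = C * h * mu1 K" by (simp add: mu1_def)
  finally show ?thesis .
qed

text \<open>The summands of the estimator are independent with common mean \<open>m\<close> and
  second moment \<open>q\<close>. Bounding \<open>p\<close> by \<open>a\<close> controls
  \<open>q\<close> through the integral of the squared kernel, and \<open>bias_le\<close> controls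
  \<open>m - p x\<close>.\<close>

lemma MSE_kernel_estimator_le:
  fixes M :: "'a measure" and X :: "nat \<Rightarrow> 'a \<Rightarrow> real" and p p' K :: "real \<Rightarrow> real"
  assumes "prob_space M" and n: "n \<ge> 1" and p: "prob_density p" and iid: "iid_sample M n X p"
    and K: "prob_density K" and K_sq: "integrable lborel (\<lambda>x. (K x)\<^sup>2)"
    and K_abs: "integrable lborel (\<lambda>x. \<bar>x\<bar> * K x)" and K_char: "integrable lborel (kernel_char K)"
    and p': "\<And>x. (p has_real_derivative p' x) (at x)" and p'_le: "\<And>x. \<bar>p' x\<bar> \<le> C"
    and p_le: "\<And>x. p x \<le> a" and h: "h > 0"
  shows "MSE M (kernel_estimator K n h X x) (p x)
    \<le> ennreal (a * A_const K / (real n * h) + (C * h * mu1 K)\<^sup>2)"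
proof -
  interpret prob_space M by fact
  have [measurable]: "p \<in> borel_measurable borel" "K \<in> borel_measurable borel"
    and p_nonneg: "\<And>x. 0 \<le> p x" and K_nonneg: "\<And>x. 0 \<le> K x"
    using p K by (auto simp: prob_density_def)
  have K_int: "integrable lborel K"
    using K by (intro integrableI_nonneg) (auto simp: prob_density_def)
  have a: "0 \<le> a" using p_nonneg[of 0] p_le[of 0] by linarith
  have int: "integrable lborel (\<lambda>u. g u * p (x - h * u))"
    if "integrable lborel g" "\<And>u. 0 \<le> g u" for g :: "real \<Rightarrow> real"
  proof (rule Bochner_Integration.integrable_bound)
    show "integrable lborel (\<lambda>u. g u * a)" using that by simp
    have [measurable]: "g \<in> borel_measurable borel" using borel_measurable_integrable[OF that(1)] by simp
    show "(\<lambda>u. g u * p (x - h * u)) \<in> borel_measurable lborel" by measurable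
    show "AE u in lborel. norm (g u * p (x - h * u)) \<le> norm (g u * a)"
      using that p_nonneg p_le a by (intro AE_I2) (auto simp: abs_mult intro!: mult_left_mono)
  qed
  define m where "m = (\<integral>u. K u * p (x - h * u) \<partial>lborel)"
  have mean: "has_bochner_integral lborel (\<lambda>y. p y * (K ((x - y) / h) / h)) m"
    unfolding m_def using int[OF K_int K_nonneg]
    by (intro has_bochner_integral_substitute_scaled_kernel h has_bochner_integral_integrable)
  define q where "q = (\<integral>u. (K u)\<^sup>2 / h * p (x - h * u) \<partial>lborel)"
  have int2: "integrable lborel (\<lambda>u. (K u)\<^sup>2 / h * p (x - h * u))"
    using K_sq h by (intro int) auto
  \<comment> \<open>One of the two divisions by \<open>h\<close> belongs to the function being
    substituted, the other is absorbed by the Jacobian.\<close>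
  have "has_bochner_integral lborel (\<lambda>y. p y * ((K ((x - y) / h))\<^sup>2 / h / h)) q"
    unfolding q_def using int2
    by (intro has_bochner_integral_substitute_scaled_kernel h has_bochner_integral_integrable)
  then have second: "has_bochner_integral lborel (\<lambda>y. p y * (K ((x - y) / h) / h)\<^sup>2) q"
    by (simp add: power2_eq_square)
  have "q \<le> (\<integral>u. (K u)\<^sup>2 / h * a \<partial>lborel)"
    unfolding q_def using K_sq h p_le int2
    by (intro integral_mono) (auto intro!: divide_right_mono mult_left_mono)
  also have "\<dots> = (\<integral>u. (K u)\<^sup>2 \<partial>lborel) * (a / h)" by simp
  also have "\<dots> \<le> A_const K * (a / h)"
    using integral_square_le_A_const[OF K K_sq K_char] a h by (intro mult_right_mono) auto
  finally have q_le: "q \<le> A_const K * (a / h)" .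
  have bias: "\<bar>m - p x\<bar> \<le> C * h * mu1 K"
    unfolding m_def using h by (intro bias_le[OF K K_abs p' p'_le] int K_int K_nonneg) simp
  define Y where "Y j \<omega> = scaled_kernel K h (x - X j \<omega>)" for j \<omega>
  have dist: "distributed M lborel (X j) (\<lambda>x. ennreal (p x))" if "j \<in> {1..n}" for j
    using iid that by (simp add: iid_sample_def)
  have E1: "has_bochner_integral M (Y j) m" if "j \<in> {1..n}" for j
    using mean distributed_integrable[OF dist[OF that], of "\<lambda>y. K ((x - y) / h) / h"]
      distributed_integral[OF dist[OF that], of "\<lambda>y. K ((x - y) / h) / h"] p_nonneg
    by (simp add: has_bochner_integral_iff Y_def[abs_def] scaled_kernel_def)
  have E2: "has_bochner_integral M (\<lambda>\<omega>. (Y j \<omega>)\<^sup>2) q" if "j \<in> {1..n}" for j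
    using second distributed_integrable[OF dist[OF that], of "\<lambda>y. (K ((x - y) / h) / h)\<^sup>2"]
      distributed_integral[OF dist[OF that], of "\<lambda>y. (K ((x - y) / h) / h)\<^sup>2"] p_nonneg
    by (simp add: has_bochner_integral_iff Y_def[abs_def] scaled_kernel_def)
  have indep: "indep_vars (\<lambda>_. borel) Y {1..n}"
    unfolding Y_def[abs_def] scaled_kernel_def
    by (rule indep_vars_compose2[where X=X and M'="\<lambda>_. borel" and Y="\<lambda>_ y. K ((x - y) / h) / h"])
       (use iid in \<open>simp_all add: iid_sample_def\<close>)
  have "MSE M (kernel_estimator K n h X x) (p x) \<le> ennreal (A_const K * (a / h) / real n + (m - p x)\<^sup>2)"
    unfolding MSE_def kernel_estimator_def Y_def[symmetric]
    using E1 E2 q_le by (intro nn_integral_mean_error_le n indep) (auto simp: has_bochner_integral_iff)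
  also have "\<dots> \<le> ennreal (a * A_const K / (real n * h) + (C * h * mu1 K)\<^sup>2)"
    using power_mono[OF bias abs_ge_zero, of 2]
    by (intro ennreal_leI) (simp add: mult_ac)
  finally show ?thesis .
qed

section \<open>The rate for a bandwidth proportional to \<open>n powr (-1/3)\<close>\<close>

theorem theorem4:
  fixes M :: "'a measure" and X :: "nat \<Rightarrow> 'a \<Rightarrow> real" and n :: nat
    and p p' p'' K :: "real \<Rightarrow> real" and V2 a h0 :: real
  assumes "prob_space M"
    and "n \<ge> 1"
    and "prob_density p"
    and "iid_sample M n X p"
    and "prob_density K"
    and "integrable lborel (\<lambda>x. (K x)\<^sup>2)"
    and "integrable lborel (\<lambda>x. \<bar>x\<bar> * K x)"
    and "integrable lborel (kernel_char K)"
    and "\<And>x. (p has_real_derivative p' x) (at x)"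
    and "\<And>x. (p' has_real_derivative p'' x) (at x)"
    and "0 \<le> V2" and "total_variation p'' = ennreal V2"
    and "\<And>x. p x \<le> a"
    and "h0 > 0"
  shows "(SUP x. MSE M (kernel_estimator K n (h0 * real n powr (-1/3)) X x) (p x))
    \<le> ennreal ((9 / (4 * pi\<^sup>2) * (mu1 K)\<^sup>2 * V2 powr (4/3) * h0\<^sup>2 + 2 * a * A_const K / h0)
                * real n powr (-2/3))"
proof (rule SUP_least)
  fix x
  define C where "C = sqrt (9 / (4 * pi\<^sup>2) * V2 powr (4/3))"
  have C_sq: "C\<^sup>2 = 9 / (4 * pi\<^sup>2) * V2 powr (4/3)" by (simp add: C_def)
  have C: "\<bar>p' t\<bar> \<le> C" for t
    using deriv_sq_le_total_variation[OF assms(3,9,10,13,11,12), of t]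
    by (simp only: C_def real_le_rsqrt power2_abs)
  \<comment> \<open>The common rate: both \<open>h\<^sup>2\<close> and
    \<open>1 / (real n * h)\<close> are constant multiples of \<open>r\<close>, so squared bias and
    variance are balanced.\<close>
  define r where "r = real n powr (-2/3)"
  define h where "h = h0 * real n powr (-1/3)"
  have n: "real n > 0" using assms(2) by simp
  have h: "h > 0" using assms(14) n by (simp add: h_def)
  have h_sq: "h\<^sup>2 = h0\<^sup>2 * r"
    using n by (simp add: h_def r_def power_mult_distrib power2_eq_square[of "_ powr _"] powr_add[symmetric])
  have nh: "1 / (real n * h) = r / h0"
  proof -
    have "r * (real n * h) = h0 * (r * (real n powr 1 * real n powr (-1/3)))"
      using n by (simp add: h_def)
    also have "\<dots> = h0" using n by (simp only: r_def powr_add[symmetric]) simp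
    finally show ?thesis using n h assms(14) by (simp add: field_simps)
  qed
  have "0 \<le> p 0" using assms(3) by (simp add: prob_density_def)
  then have a: "0 \<le> a" using assms(13)[of 0] by linarith
  have A: "0 \<le> A_const K" by (simp add: A_const_def)
  have "MSE M (kernel_estimator K n h X x) (p x)
      \<le> ennreal (a * A_const K / (real n * h) + (C * h * mu1 K)\<^sup>2)"
    by (rule MSE_kernel_estimator_le[OF assms(1-9) C assms(13) h])
  also have "\<dots> \<le> ennreal ((9 / (4 * pi\<^sup>2) * (mu1 K)\<^sup>2 * V2 powr (4/3) * h0\<^sup>2 + 2 * a * A_const K / h0) * r)"
  proof (rule ennreal_leI)
    have "a * A_const K / (real n * h) = a * A_const K * (1 / (real n * h))" by simp
    also have "\<dots> = a * A_const K / h0 * r" unfolding nh by simp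
    \<comment> \<open>The variance estimate is half of the term allowed; doubling it is harmless
      since \<open>a\<close>, \<open>A_const K\<close> and \<open>r\<close> are nonnegative.\<close>
    also have "\<dots> \<le> 2 * a * A_const K / h0 * r"
      using a A assms(14) by (intro mult_right_mono divide_right_mono) (auto simp: r_def)
    finally have 1: "a * A_const K / (real n * h) \<le> 2 * a * A_const K / h0 * r" .
    have 2: "(C * h * mu1 K)\<^sup>2 = 9 / (4 * pi\<^sup>2) * (mu1 K)\<^sup>2 * V2 powr (4/3) * h0\<^sup>2 * r"
      unfolding power_mult_distrib C_sq h_sq by simp
    show "a * A_const K / (real n * h) + (C * h * mu1 K)\<^sup>2
        \<le> (9 / (4 * pi\<^sup>2) * (mu1 K)\<^sup>2 * V2 powr (4/3) * h0\<^sup>2 + 2 * a * A_const K / h0) * r"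
      unfolding 2 distrib_right using 1 by linarith
  qed
  finally show "MSE M (kernel_estimator K n (h0 * real n powr (-1/3)) X x) (p x)
    \<le> ennreal ((9 / (4 * pi\<^sup>2) * (mu1 K)\<^sup>2 * V2 powr (4/3) * h0\<^sup>2 + 2 * a * A_const K / h0)
                * real n powr (-2/3))"
    by (simp only: h_def r_def)
qed

end
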